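(* Let $f:\operatorname{dom}(f)\subseteq\mathbb{R}^p\to\mathbb{R}$ and $g:\operatorname{dom}(g)\subseteq\mathbb{R}^n\to\mathbb{R}^p$, and let $\mathcal{X}=\langle x^0,x^0+d^1,\ldots,x^0+d^m\rangle$ be an ordered set of $m+1$ distinct points such that $\mathcal{X}\cup\mathcal{X}^-$ is contained in $\operatorname{dom}(g)$, $g(\mathcal{X})\cup g(\mathcal{X})^-$ is contained in $\operatorname{dom}(f)$, and $g(x^0-d^i)\in\operatorname{dom}(f)$ for $i=1,\ldots,m$. Let $S=S(\mathcal{X})$ and $S_g=S(g(\mathcal{X}))$. Then $$\nabla^c(f\circ g)(\mathcal{X})=J^c_g(\mathcal{X})^\top\,\nabla^c f(g(\mathcal{X}))-E,$$ where \begin{align*} E&=(S^\top)^\dagger\delta^c_g(\mathcal{X})(S_g^\top)^\dagger\widetilde{E}+(S^\top)^\dagger\widehat{E}\,\delta^c_f(g(\mathcal{X}))-(S^\top)^\dagger\widehat{E}\widetilde{E},\\ \widetilde{E}&=\delta^c_f(g(\mathcal{X}))-\delta^c_{f\circ g}(\mathcal{X})\in\mathbb{R}^m,\\ \widehat{E}&=\delta^c_g(\mathcal{X})(S_g^\top)^\dagger-\operatorname{Id}\in\mathbb{R}^{m\times m}. \end{align*}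
   Context: $A^\dagger$ denotes the Moore--Penrose pseudoinverse of a matrix $A$. For an ordered list of points $\mathcal{Z}=\langle z^0,z^0+e^1,\ldots,z^0+e^m\rangle$ in a Euclidean space put $S(\mathcal{Z})=[e^1\ \cdots\ e^m]$ and $\mathcal{Z}^-=\langle z^0,z^0-e^1,\ldots,z^0-e^m\rangle$. For a real-valued $h$, $\delta^c_h(\mathcal{Z})\in\mathbb{R}^m$ has $i$-th entry $\tfrac12\big(h(z^0+e^i)-h(z^0-e^i)\big)$, and the generalized centred simplex gradient of $h$ over $\mathcal{Z}$ is $\nabla^c h(\mathcal{Z})=(S(\mathcal{Z})^\top)^\dagger\delta^c_h(\mathcal{Z})$. For $g=[g_1\ \cdots\ g_p]^\top$, $\delta^c_g(\mathcal{X})=[\delta^c_{g_1}(\mathcal{X})\ \cdots\ \delta^c_{g_p}(\mathcal{X})]\in\mathbb{R}^{m\times p}$, and the generalized centred simplex Jacobian $J^c_g(\mathcal{X})\in\mathbb{R}^{p\times n}$ is the matrix whose $i$-th row is $\nabla^c g_i(\mathcal{X})^\top$. With $h^i=g(x^0+d^i)-g(x^0)$, one sets $g(\mathcal{X})=\langle g(x^0),g(x^0)+h^1,\ldots,g(x^0)+h^m\rangle$ and $g(\mathcal{X})^-=\langle g(x^0),g(x^0)-h^1,\ldots,g(x^0)-h^m\rangle$, so $S_g=[h^1\ \cdots\ h^m]\in\mathbb{R}^{p\times m}$ and $\delta^c_f(g(\mathcal{X}))$ has $i$-th entry $\tfrac12\big(f(g(x^0)+h^i)-f(g(x^0)-h^i)\big)$.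 *)

theory Defs
  imports "HOL-Analysis.Analysis"
begin

section \<open>Moore--Penrose pseudoinverse\<close>

definition is_moore_penrose :: "real^'c^'r \<Rightarrow> real^'r^'c \<Rightarrow> bool" where
  "is_moore_penrose A B \<longleftrightarrow>
     A ** B ** A = A \<and> B ** A ** B = B \<and>
     transpose (A ** B) = A ** B \<and> transpose (B ** A) = B ** A"

definition pinv :: "real^'c^'r \<Rightarrow> real^'r^'c" where
  "pinv A = (THE B. is_moore_penrose A B)"

lemma is_moore_penrose_unique:
  fixes A :: "real^'c^'r"
  assumes B: "is_moore_penrose A B" and C: "is_moore_penrose A C"
  shows "B = C"
proof -
  have AB: "A ** B = A ** C"
  proof -
    have "A ** B = transpose (A ** C ** A ** B)"
      using B C by (simp add: is_moore_penrose_def)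
    also have "\<dots> = transpose (A ** B) ** transpose (A ** C)"
      by (metis matrix_transpose_mul matrix_mul_assoc)
    also have "\<dots> = A ** B ** A ** C"
      using B C by (simp add: is_moore_penrose_def matrix_mul_assoc)
    finally show ?thesis using B by (simp add: is_moore_penrose_def)
  qed
  have BA: "B ** A = C ** A"
  proof -
    have "B ** A = transpose (B ** (A ** C ** A))"
      using B C by (simp add: is_moore_penrose_def)
    also have "\<dots> = transpose (C ** A) ** transpose (B ** A)"
      by (metis matrix_transpose_mul matrix_mul_assoc)
    also have "\<dots> = C ** A ** (B ** A)"
      using B C by (simp add: is_moore_penrose_def)
    also have "\<dots> = C ** (A ** B ** A)" by (simp add: matrix_mul_assoc)
    finally show ?thesis using B by (simp add: is_moore_penrose_def)
  qed
  have "B = B ** A ** B" using B by (simp add: is_moore_penrose_def)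
  also have "\<dots> = C ** (A ** C)" using AB BA by (metis matrix_mul_assoc)
  also have "\<dots> = C" using C by (simp add: is_moore_penrose_def matrix_mul_assoc)
  finally show ?thesis .
qed

lemma normal_equations_solvable:
  fixes A :: "real^'c^'r"
  obtains G where "transpose A ** A ** G = transpose A"
proof -
  have ex: "\<exists>x. transpose A *v (A *v x) = transpose A *v y" for y
  proof -
    obtain a z where az: "a \<in> span (range ((*v) A))"
      "\<And>w. w \<in> span (range ((*v) A)) \<Longrightarrow> orthogonal z w" "y = a + z"
      by (rule orthogonal_subspace_decomp_exists) blast
    have "subspace (range ((*v) A))"
      by (intro linear_subspace_image) (auto simp: matrix_vector_mul_linear)
    then have sp: "span (range ((*v) A)) = range ((*v) A)" by (simp only: span_eq_iff)
    obtain x where x: "a = A *v x" using az(1) unfolding sp by blast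
    have "(transpose A *v z) \<bullet> w = 0" for w
    proof -
      have "z \<bullet> (A *v w) = 0"
        using az(2)[of "A *v w"] by (auto simp only: sp orthogonal_def)
      then show ?thesis by (simp add: dot_lmul_matrix)
    qed
    then have "transpose A *v z = 0" by (metis inner_eq_zero_iff)
    then show ?thesis using x az(3) by (auto simp: matrix_vector_right_distrib intro!: exI[of _ x])
  qed
  then obtain X where X: "\<And>y. transpose A *v (A *v X y) = transpose A *v y" by metis
  define G :: "real^'r^'c" where "G = (\<chi> i j. X (axis j 1) $ i)"
  have col: "G *v axis j 1 = X (axis j 1)" for j
    by (simp add: G_def matrix_vector_mul_component matrix_vector_mult_basis column_def vec_eq_iff)
  have "(transpose A ** A ** G) *v axis j 1 = transpose A *v axis j 1" for j
    by (simp only: col X matrix_vector_mul_assoc[symmetric])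
  then have "column j (transpose A ** A ** G) = column j (transpose A)" for j
    by (simp add: matrix_vector_mult_basis)
  then have "transpose A ** A ** G = transpose A"
    by (simp add: vec_eq_iff column_def)
  then show thesis by (rule that)
qed

lemma normal_equations_inverse:
  fixes A :: "real^'c^'r"
  assumes G: "transpose A ** A ** G = transpose A"
  shows "A ** G ** A = A" "transpose (A ** G) = A ** G"
proof -
  have "transpose (A ** G) = transpose G ** (transpose A ** A ** G)"
    using G by (simp add: matrix_transpose_mul)
  also have "\<dots> = transpose (A ** G) ** (A ** G)"
    by (simp add: matrix_transpose_mul matrix_mul_assoc)
  finally have *: "transpose (A ** G) = transpose (A ** G) ** (A ** G)" .
  then have "transpose (transpose (A ** G)) = transpose (A ** G) ** (A ** G)"
    by (metis matrix_transpose_mul transpose_transpose)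
  with * show sym: "transpose (A ** G) = A ** G" by simp
  have "A = transpose (transpose A ** (A ** G))"
    using G by (simp add: matrix_mul_assoc)
  also have "\<dots> = A ** G ** A"
    by (simp add: matrix_transpose_mul[of "transpose A"] sym)
  finally show "A ** G ** A = A" by simp
qed

lemma is_moore_penrose_exists:
  fixes A :: "real^'c^'r"
  shows "\<exists>B. is_moore_penrose A B"
proof -
  obtain G where G: "transpose A ** A ** G = transpose A"
    by (rule normal_equations_solvable)
  obtain K where K: "transpose (transpose A) ** transpose A ** K = transpose (transpose A)"
    by (rule normal_equations_solvable)
  define H where "H = transpose K"
  note G' = normal_equations_inverse[OF G] and K' = normal_equations_inverse[OF K]
  have H1: "A ** H ** A = A"
    using arg_cong[OF K'(1), of transpose] by (simp add: H_def matrix_transpose_mul matrix_mul_assoc)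
  have H2: "transpose (H ** A) = H ** A"
    using K'(2) by (simp add: H_def matrix_transpose_mul)
  have "A ** (H ** A ** G) = A ** G" by (simp add: H1 matrix_mul_assoc)
  moreover have "(H ** A ** G) ** A = H ** A" by (metis G'(1) matrix_mul_assoc)
  moreover have "H ** A ** (H ** A ** G) = H ** A ** G" by (metis H1 matrix_mul_assoc)
  ultimately have "is_moore_penrose A (H ** A ** G)"
    using G' H1 H2 by (simp add: is_moore_penrose_def)
  then show ?thesis by blast
qed

lemma is_moore_penrose_pinv: "is_moore_penrose A (pinv A)"
  unfolding pinv_def
  by (rule theI') (use is_moore_penrose_exists is_moore_penrose_unique in blast)

section \<open>Generalized centred simplex gradient and Jacobian\<close>

text \<open>
  An ordered list of points \<open>\<langle>z0, z0 + e 1, \<dots>, z0 + e m\<rangle>\<close> is given by its base point \<open>z0\<close>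
  and its family of directions \<open>e\<close>, indexed by a finite type with \<open>m\<close> elements. The reflected
  list \<open>\<langle>z0, z0 - e 1, \<dots>, z0 - e m\<rangle>\<close> then has base point \<open>z0\<close> and directions \<open>\<lambda>i. - e i\<close>.
  Note that \<open>real^'c^'r\<close> is the type of matrices with rows indexed by \<open>'r\<close> and columns by \<open>'c\<close>.
\<close>

definition point_set :: "real^'n \<Rightarrow> ('m::finite \<Rightarrow> real^'n) \<Rightarrow> (real^'n) set" where
  "point_set z0 e = insert z0 (range (\<lambda>i. z0 + e i))"

definition direction_matrix :: "('m::finite \<Rightarrow> real^'n) \<Rightarrow> real^'m^'n" where
  "direction_matrix e = (\<chi> k i. e i $ k)"

definition centred_diff ::
    "(real^'n \<Rightarrow> real) \<Rightarrow> real^'n \<Rightarrow> ('m::finite \<Rightarrow> real^'n) \<Rightarrow> real^'m" where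
  "centred_diff h z0 e = (\<chi> i. (1/2) * (h (z0 + e i) - h (z0 - e i)))"

definition centred_simplex_gradient ::
    "(real^'n \<Rightarrow> real) \<Rightarrow> real^'n \<Rightarrow> ('m::finite \<Rightarrow> real^'n) \<Rightarrow> real^'n" where
  "centred_simplex_gradient h z0 e =
     pinv (transpose (direction_matrix e)) *v centred_diff h z0 e"

definition centred_diff_matrix ::
    "(real^'n \<Rightarrow> real^'p) \<Rightarrow> real^'n \<Rightarrow> ('m::finite \<Rightarrow> real^'n) \<Rightarrow> real^'p^'m" where
  "centred_diff_matrix g z0 e = (\<chi> i k. centred_diff (\<lambda>x. g x $ k) z0 e $ i)"

definition centred_simplex_jacobian ::
    "(real^'n \<Rightarrow> real^'p) \<Rightarrow> real^'n \<Rightarrow> ('m::finite \<Rightarrow> real^'n) \<Rightarrow> real^'n^'p" where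
  "centred_simplex_jacobian g z0 e = (\<chi> k. centred_simplex_gradient (\<lambda>x. g x $ k) z0 e)"

text \<open>The directions of the list \<open>\<langle>g z0, g (z0 + e 1), \<dots>, g (z0 + e m)\<rangle>\<close>, whose base point is
  \<open>g z0\<close>.\<close>

definition image_directions ::
    "(real^'n \<Rightarrow> real^'p) \<Rightarrow> real^'n \<Rightarrow> ('m::finite \<Rightarrow> real^'n) \<Rightarrow> 'm \<Rightarrow> real^'p" where
  "image_directions g z0 e = (\<lambda>i. g (z0 + e i) - g z0)"

end

theory Submission
  imports Defs
begin

text \<open>
  Column \<open>k\<close> of the transposed Jacobian is \<open>(S\<^sup>T)\<^sup>\<dagger>\<close> applied to the centred differences of \<open>g\<^sub>k\<close>,
  so the whole of it is \<open>(S\<^sup>T)\<^sup>\<dagger>\<close> times the centred difference matrix of \<open>g\<close>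
  (\<open>transpose_centred_simplex_jacobian\<close>). Let \<open>A\<close> be this difference matrix times \<open>(Sg\<^sup>T)\<^sup>\<dagger>\<close>, let
  \<open>v\<close> be the centred differences of \<open>f\<close> at \<open>g x0\<close> and \<open>u\<close> those of \<open>f \<circ> g\<close> at \<open>x0\<close>. The gradient of
  \<open>f \<circ> g\<close> and the Jacobian product are then the images under \<open>(S\<^sup>T)\<^sup>\<dagger>\<close> of \<open>u\<close> and of \<open>A v\<close>, so the
  error must be the image of \<open>A v - u\<close>. There are two sources of this discrepancy: \<open>A\<close> differs from
  the identity by \<open>Ehat\<close>, and \<open>v\<close> differs from \<open>u\<close> by \<open>Etilde\<close>. A discrete product rule
  (\<open>matrix_vector_perturbation\<close>) separates the two effects and yields the three terms of \<open>E\<close>.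
\<close>

lemma transpose_centred_simplex_jacobian:
  "transpose (centred_simplex_jacobian g z0 e) =
     pinv (transpose (direction_matrix e)) ** centred_diff_matrix g z0 e"
  by (simp add: vec_eq_iff transpose_def centred_simplex_jacobian_def
      centred_simplex_gradient_def centred_diff_matrix_def matrix_vector_mult_def
      matrix_matrix_mult_def)

text \<open>
  Expand \<open>A v - u\<close> with \<open>A = Id + (A - Id)\<close> and \<open>v = u + (v - u)\<close>. The product
  \<open>(A - Id) (v - u)\<close> of the two perturbations is contained in each of the first two terms on the
  right, and so has to be subtracted once.
\<close>

lemma matrix_vector_perturbation:
  fixes A :: "real^'m^'m" and u v :: "real^'m"
  shows "A *v v - u = A *v (v - u) + (A - mat 1) *v v - (A - mat 1) *v (v - u)"
  by (simp add: matrix_vector_mult_diff_rdistrib matrix_vector_mult_diff_distrib)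

theorem proposition4p8:
  fixes f :: "real^'p \<Rightarrow> real" and domf :: "(real^'p) set"
    and g :: "real^'n \<Rightarrow> real^'p" and domg :: "(real^'n) set"
    and x0 :: "real^'n" and d :: "'m::finite \<Rightarrow> real^'n" and h :: "'m \<Rightarrow> real^'p"
  assumes distinct: "inj (\<lambda>i. x0 + d i)" "x0 \<notin> range (\<lambda>i. x0 + d i)"
    and h: "h = image_directions g x0 d"
    and dom_g: "point_set x0 d \<union> point_set x0 (\<lambda>i. - d i) \<subseteq> domg"
    and dom_f: "point_set (g x0) h \<union> point_set (g x0) (\<lambda>i. - h i) \<subseteq> domf"
    and dom_fg: "\<And>i. g (x0 - d i) \<in> domf"
  shows
    "let S = direction_matrix d;
         Sg = direction_matrix h;
         Etilde = centred_diff f (g x0) h - centred_diff (f \<circ> g) x0 d;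
         Ehat = centred_diff_matrix g x0 d ** pinv (transpose Sg) - mat 1;
         E = (pinv (transpose S) ** centred_diff_matrix g x0 d ** pinv (transpose Sg)) *v Etilde
             + (pinv (transpose S) ** Ehat) *v centred_diff f (g x0) h
             - (pinv (transpose S) ** Ehat) *v Etilde
     in centred_simplex_gradient (f \<circ> g) x0 d =
          transpose (centred_simplex_jacobian g x0 d) *v centred_simplex_gradient f (g x0) h - E"
proof -
  define P where "P = pinv (transpose (direction_matrix d))"
  define A where "A = centred_diff_matrix g x0 d ** pinv (transpose (direction_matrix h))"
  define u where "u = centred_diff (f \<circ> g) x0 d"
  define v where "v = centred_diff f (g x0) h"
  have J: "transpose (centred_simplex_jacobian g x0 d) *v centred_simplex_gradient f (g x0) h
      = P *v (A *v v)"
    by (simp add: transpose_centred_simplex_jacobian centred_simplex_gradient_def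
        P_def A_def v_def matrix_vector_mul_assoc matrix_mul_assoc)
  have E: "(P ** centred_diff_matrix g x0 d ** pinv (transpose (direction_matrix h))) *v (v - u)
      + (P ** (A - mat 1)) *v v - (P ** (A - mat 1)) *v (v - u) = P *v (A *v v - u)"
    unfolding matrix_vector_perturbation[of A v u]
    by (simp only: A_def matrix_mul_assoc[symmetric] matrix_vector_mul_assoc[symmetric]
        matrix_vector_right_distrib matrix_vector_mult_diff_distrib)
  have "P *v u = P *v (A *v v) - P *v (A *v v - u)"
    by (simp add: matrix_vector_mult_diff_distrib)
  then show ?thesis
    unfolding Let_def J P_def[symmetric] A_def[symmetric] u_def[symmetric] v_def[symmetric] E
    by (simp add: centred_simplex_gradient_def P_def u_def)
qed

end
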